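(* For every $n\ge1$, the dimension of the vector space $\mathfrak{P}_n$ defined in the context is equal to the $n$-th Catalan number $c_n=\frac{1}{n+1}\binom{2n}{n}$.
   Context: All vector spaces and algebras are over $\mathbb{C}$; algebras are unital and associative; modules are right modules. $\mathfrak{A}$ is the associative algebra with generators $e[i]$ ($i\in\mathbb{Z}$) and relations $\{e[i],e[j]\}=\{e[i+1],e[j-1]\}$ for all $i,j\in\mathbb{Z}$, where $\{a,b\}=ab+ba$. Let $\mathfrak{A}_+$ be the subalgebra generated by all $e[i]$ with $i>0$, and let $\mathfrak{M}=\mathbb{C}v\otimes_{\mathfrak{A}_+}\mathfrak{A}$ be the right $\mathfrak{A}$-module induced from the trivial one-dimensional right $\mathfrak{A}_+$-module $\mathbb{C}v$, where $v e[i]=0$ for all $i>0$. Let $\mathfrak{A}_{\ge0}$ be the linear span of the $e[i]$ with $i\ge0$. Then $\mathfrak{P}_n\subset\mathfrak{M}$ is the image of the linear map $\mathfrak{A}_{\ge0}^{\otimes n}\to\mathfrak{M}$, $e[i_1]\otimes\cdots\otimes e[i_n]\mapsto v e[i_1]\cdots e[i_n]$. *)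

theory Defs
  imports Complex_Main "HOL-Library.Poly_Mapping"
begin

section \<open>Free vector spaces and the free algebra on the symbols e[i]\<close>

definition pm_scale :: "complex \<Rightarrow> ('k \<Rightarrow>\<^sub>0 complex) \<Rightarrow> ('k \<Rightarrow>\<^sub>0 complex)" where
  "pm_scale c f = Poly_Mapping.map ((*) c) f"

lemma lookup_pm_scale [simp]:
  "Poly_Mapping.lookup (pm_scale c f) k = c * Poly_Mapping.lookup f k"
  by (simp add: pm_scale_def Poly_Mapping.map.rep_eq when_def)

global_interpretation free_vs: vector_space "pm_scale :: complex \<Rightarrow> ('k \<Rightarrow>\<^sub>0 complex) \<Rightarrow> _"
  by unfold_locales (simp_all add: poly_mapping_eq_iff fun_eq_iff lookup_add algebra_simps)

text \<open>Words form the free monoid, written additively because the convolution product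
  of \<open>Poly_Mapping\<close> expects a \<open>monoid_add\<close> of keys. Thus \<^typ>\<open>'a \<Rightarrow>\<^sub>0 complex\<close> with
  words as keys is the free associative unital algebra.\<close>

datatype 'a free_word = Word (letters: "'a list")

instantiation free_word :: (type) monoid_add
begin
definition zero_free_word :: "'a free_word" where "0 = Word []"
definition plus_free_word :: "'a free_word \<Rightarrow> 'a free_word \<Rightarrow> 'a free_word"
  where "u + w = Word (letters u @ letters w)"
instance
  by standard (simp_all add: zero_free_word_def plus_free_word_def)
end

type_synonym free_alg = "int free_word \<Rightarrow>\<^sub>0 complex"

definition gen :: "int \<Rightarrow> free_alg" where
  "gen i = Poly_Mapping.single (Word [i]) 1"

lemma pm_scale_conv_mult: "pm_scale c (x :: free_alg) = Poly_Mapping.single 0 c * x"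
  by (simp add: pm_scale_def mult_map_scale_conv_mult)

lemma single_0_commute: "Poly_Mapping.single 0 c * x = x * Poly_Mapping.single 0 c"
  for x :: free_alg
proof -
  have *: "Poly_Mapping.single 0 c * x = x * Poly_Mapping.single 0 c"
    if "x = Poly_Mapping.single k d" for x :: free_alg and k d
    using that by (simp add: mult_single mult.commute)
  show ?thesis
  proof (induction x rule: update_induct)
    case const
    show ?case by simp
  next
    case (update f a b)
    have "Poly_Mapping.update a b f = f + Poly_Mapping.single a b"
      using update(1) by (intro poly_mapping_eqI)
        (auto simp: lookup_update lookup_add lookup_single when_def in_keys_iff)
    with update show ?case by (simp add: algebra_simps mult_single)
  qed
qed

lemma pm_scale_mult_left: "pm_scale c x * y = pm_scale c (x * y)" for x y :: free_alg
  by (simp add: pm_scale_conv_mult mult.assoc)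

lemma pm_scale_mult_right: "x * pm_scale c y = pm_scale c (x * y)" for x y :: free_alg
  by (metis pm_scale_conv_mult single_0_commute mult.assoc)


section \<open>The algebra A\<close>

definition two_sided_ideal :: "'a::ring_1 set \<Rightarrow> bool" where
  "two_sided_ideal J \<longleftrightarrow> 0 \<in> J \<and> (\<forall>x\<in>J. \<forall>y\<in>J. x + y \<in> J) \<and>
     (\<forall>x\<in>J. \<forall>r. r * x \<in> J \<and> x * r \<in> J)"

definition anticomm :: "'a::ring_1 \<Rightarrow> 'a \<Rightarrow> 'a" where
  "anticomm a b = a * b + b * a"

definition rel_ideal :: "free_alg set" where
  "rel_ideal = two_sided_ideal hull
     {anticomm (gen i) (gen j) - anticomm (gen (i + 1)) (gen (j - 1)) | i j. True}"

lemma two_sided_ideal_Inter: "(\<And>J. J \<in> F \<Longrightarrow> two_sided_ideal J) \<Longrightarrow> two_sided_ideal (\<Inter>F)"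
  by (auto simp: two_sided_ideal_def)

lemma two_sided_ideal_rel_ideal: "two_sided_ideal rel_ideal"
  unfolding rel_ideal_def by (rule hull_in) (rule two_sided_ideal_Inter, blast)

lemma rel_ideal_0: "0 \<in> rel_ideal"
  and rel_ideal_add: "x \<in> rel_ideal \<Longrightarrow> y \<in> rel_ideal \<Longrightarrow> x + y \<in> rel_ideal"
  and rel_ideal_mult_left: "x \<in> rel_ideal \<Longrightarrow> r * x \<in> rel_ideal"
  and rel_ideal_mult_right: "x \<in> rel_ideal \<Longrightarrow> x * r \<in> rel_ideal"
  using two_sided_ideal_rel_ideal by (auto simp: two_sided_ideal_def)

lemma rel_ideal_uminus: "x \<in> rel_ideal \<Longrightarrow> - x \<in> rel_ideal"
  using rel_ideal_mult_left[of x "- 1"] by simp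

lemma rel_ideal_scale: "x \<in> rel_ideal \<Longrightarrow> pm_scale c x \<in> rel_ideal"
  by (simp add: pm_scale_conv_mult rel_ideal_mult_left)

text \<open>The constant coefficient is multiplicative and kills the relations; this gives the
  augmentation of A, through which the trivial module is defined below.\<close>

lemma free_word_add_eq_0 [simp]: "u + w = 0 \<longleftrightarrow> u = 0 \<and> w = 0" for u w :: "'a free_word"
  by (cases u; cases w) (auto simp: zero_free_word_def plus_free_word_def)

lemma lookup_0_mult:
  "Poly_Mapping.lookup (x * y) 0 = Poly_Mapping.lookup x 0 * Poly_Mapping.lookup y 0"
  for x y :: free_alg
proof -
  have inner: "(\<Sum>q. (Poly_Mapping.lookup y q when 0 = l + q)) = (Poly_Mapping.lookup y 0 when l = 0)"
    for l :: "int free_word"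
  proof -
    have "(\<lambda>q. Poly_Mapping.lookup y q when 0 = l + q)
        = (\<lambda>q. (Poly_Mapping.lookup y q when l = 0) when q = 0)"
      using free_word_add_eq_0[of l] by (auto simp: fun_eq_iff when_def eq_commute[of 0 "l + _"])
    then show ?thesis by (simp only: Sum_any_when_equal)
  qed
  have "Poly_Mapping.lookup (x * y) 0
      = (\<Sum>l. Poly_Mapping.lookup x l * (Poly_Mapping.lookup y 0 when l = 0))"
    by (simp only: lookup_mult inner)
  also have "\<dots> = (\<Sum>l. (Poly_Mapping.lookup x l * Poly_Mapping.lookup y 0) when l = 0)"
    by (rule arg_cong[where f = Sum_any]) (auto simp: when_def)
  finally show ?thesis by simp
qed

lemma lookup_0_gen [simp]: "Poly_Mapping.lookup (gen i) 0 = 0"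
  by (simp add: gen_def lookup_single when_def zero_free_word_def)

lemma lookup_0_rel_ideal:
  assumes "x \<in> rel_ideal" shows "Poly_Mapping.lookup x 0 = 0"
proof -
  have "rel_ideal \<subseteq> {x. Poly_Mapping.lookup x 0 = 0}"
    unfolding rel_ideal_def
    by (rule hull_minimal)
       (auto simp: two_sided_ideal_def anticomm_def lookup_add lookup_minus lookup_0_mult)
  then show ?thesis using assms by blast
qed

definition alg_rel :: "free_alg \<Rightarrow> free_alg \<Rightarrow> bool" where
  "alg_rel x y \<longleftrightarrow> x - y \<in> rel_ideal"

quotient_type frakA = free_alg / alg_rel
proof (rule equivpI)
  show "reflp alg_rel" by (rule reflpI) (simp add: alg_rel_def rel_ideal_0)
  show "symp alg_rel"
    using rel_ideal_uminus by (fastforce intro: sympI simp: alg_rel_def)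
  show "transp alg_rel"
    using rel_ideal_add by (fastforce intro: transpI simp: alg_rel_def)
qed

instantiation frakA :: ring_1
begin

lift_definition zero_frakA :: frakA is 0 .
lift_definition one_frakA :: frakA is 1 .

lift_definition plus_frakA :: "frakA \<Rightarrow> frakA \<Rightarrow> frakA" is "(+)"
  unfolding alg_rel_def by (drule (1) rel_ideal_add) (simp add: algebra_simps)

lift_definition uminus_frakA :: "frakA \<Rightarrow> frakA" is uminus
  unfolding alg_rel_def by (drule rel_ideal_uminus) (simp add: algebra_simps)

lift_definition minus_frakA :: "frakA \<Rightarrow> frakA \<Rightarrow> frakA" is "(-)"
  unfolding alg_rel_def by (drule rel_ideal_uminus, drule (1) rel_ideal_add) (simp add: algebra_simps)

lift_definition times_frakA :: "frakA \<Rightarrow> frakA \<Rightarrow> frakA" is "(*)"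
proof -
  fix x x' y y' :: free_alg
  assume "alg_rel x x'" "alg_rel y y'"
  then have "(x - x') * y + x' * (y - y') \<in> rel_ideal"
    by (simp add: alg_rel_def rel_ideal_add rel_ideal_mult_left rel_ideal_mult_right)
  then show "alg_rel (x * y) (x' * y')" by (simp add: alg_rel_def algebra_simps)
qed

instance
proof
  show "(0 :: frakA) \<noteq> 1"
    by transfer (auto simp: alg_rel_def lookup_minus dest: lookup_0_rel_ideal)
qed (transfer; simp add: alg_rel_def rel_ideal_0 algebra_simps)+

end

lift_definition scaleA :: "complex \<Rightarrow> frakA \<Rightarrow> frakA" is pm_scale
  unfolding alg_rel_def free_vs.scale_right_diff_distrib[symmetric] by (rule rel_ideal_scale)

global_interpretation A: vector_space scaleA
  by unfold_locales
    (transfer; simp add: alg_rel_def rel_ideal_0 free_vs.scale_right_distrib free_vs.scale_left_distrib)+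

lemma scaleA_mult_left: "scaleA c x * y = scaleA c (x * y)"
  by transfer (simp add: alg_rel_def rel_ideal_0 pm_scale_mult_left)

lemma scaleA_mult_right: "x * scaleA c y = scaleA c (x * y)"
  by transfer (simp add: alg_rel_def rel_ideal_0 pm_scale_mult_right)

lift_definition e :: "int \<Rightarrow> frakA" is gen .

lemma e_rel: "anticomm (e i) (e j) = anticomm (e (i + 1)) (e (j - 1))"
  unfolding anticomm_def
proof transfer
  fix i j
  have "anticomm (gen i) (gen j) - anticomm (gen (i + 1)) (gen (j - 1)) \<in> rel_ideal"
    unfolding rel_ideal_def by (rule hull_inc) blast
  then show "alg_rel (gen i * gen j + gen j * gen i)
      (gen (i + 1) * gen (j - 1) + gen (j - 1) * gen (i + 1))"
    by (simp add: alg_rel_def anticomm_def)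
qed

definition subalgebra :: "frakA set \<Rightarrow> bool" where
  "subalgebra S \<longleftrightarrow> A.subspace S \<and> 1 \<in> S \<and> (\<forall>x\<in>S. \<forall>y\<in>S. x * y \<in> S)"

definition A_plus :: "frakA set" where
  "A_plus = subalgebra hull (e ` {0<..})"


section \<open>The trivial module of the positive subalgebra and the induced module\<close>

lift_definition augmentation :: "frakA \<Rightarrow> complex" is "\<lambda>x. Poly_Mapping.lookup x 0"
  unfolding alg_rel_def by (drule lookup_0_rel_ideal) (simp add: lookup_minus)

text \<open>The line spanned by v is \<^typ>\<open>complex\<close> with \<open>v = 1\<close>. On \<^const>\<open>A_plus\<close> the following
  is the unique unital linear right action with \<open>v e[i] = 0\<close> for \<open>i > 0\<close>, see the lemmas.\<close>

definition triv_act :: "complex \<Rightarrow> frakA \<Rightarrow> complex" where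
  "triv_act z b = z * augmentation b"

lemma augmentation_add: "augmentation (a + b) = augmentation a + augmentation b"
  by transfer (simp add: lookup_add)

lemma augmentation_mult: "augmentation (a * b) = augmentation a * augmentation b"
  by transfer (simp add: lookup_0_mult)

lemma augmentation_one: "augmentation 1 = 1"
  by transfer simp

lemma augmentation_scaleA: "augmentation (scaleA c a) = c * augmentation a"
  by transfer simp

lemma augmentation_e: "augmentation (e i) = 0"
  by transfer simp

lemma triv_act_one: "triv_act z 1 = z"
  and triv_act_mult: "triv_act z (a * b) = triv_act (triv_act z a) b"
  and triv_act_add_left: "triv_act (z + z') a = triv_act z a + triv_act z' a"
  and triv_act_add_right: "triv_act z (a + b) = triv_act z a + triv_act z b"
  and triv_act_scale: "triv_act z (scaleA c a) = c * triv_act z a"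
  and triv_act_scale_left: "triv_act (c * z) a = c * triv_act z a"
  and triv_act_e: "triv_act z (e i) = 0"
  by (simp_all add: triv_act_def augmentation_one augmentation_mult augmentation_add
      augmentation_scaleA augmentation_e algebra_simps)

lemma triv_act_unique:
  fixes act :: "complex \<Rightarrow> frakA \<Rightarrow> complex"
  assumes "\<And>z. act z 1 = z"
    and "\<And>z a b. a \<in> A_plus \<Longrightarrow> b \<in> A_plus \<Longrightarrow> act z (a * b) = act (act z a) b"
    and "\<And>z a b. a \<in> A_plus \<Longrightarrow> b \<in> A_plus \<Longrightarrow> act z (a + b) = act z a + act z b"
    and "\<And>z c a. a \<in> A_plus \<Longrightarrow> act z (scaleA c a) = c * act z a"
    and "\<And>c z a. a \<in> A_plus \<Longrightarrow> act (c * z) a = c * act z a"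
    and "\<And>i. i > 0 \<Longrightarrow> act 1 (e i) = 0"
    and "a \<in> A_plus"
  shows "act z a = triv_act z a"
proof -
  have e: "e i \<in> A_plus" if "i > 0" for i
    unfolding A_plus_def by (rule hull_inc) (use that in auto)
  have sub: "subalgebra A_plus"
    unfolding A_plus_def
    by (rule hull_in) (auto simp: subalgebra_def A.subspace_def)
  have act: "act z b = z * act 1 b" if "b \<in> A_plus" for z b
    using assms(5)[OF that, of z 1] by simp
  let ?S = "{b \<in> A_plus. act 1 b = augmentation b}"
  have "A_plus \<subseteq> ?S"
    unfolding A_plus_def
  proof (rule hull_minimal, fold A_plus_def)
    show "e ` {0<..} \<subseteq> ?S" using e assms(6) by (auto simp: augmentation_e)
    have "act 1 0 = 0" using assms(4)[of 0 1 0] sub by (simp add: subalgebra_def A.subspace_def)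
    moreover have "augmentation 0 = 0" using augmentation_scaleA[of 0 0] by simp
    moreover have "act 1 (x * y) = augmentation (x * y)" if "x \<in> ?S" "y \<in> ?S" for x y
    proof -
      have "act 1 (x * y) = act (act 1 x) y" using that assms(2) by simp
      also have "\<dots> = act 1 x * act 1 y" using that by (intro act) simp
      finally show ?thesis using that by (simp add: augmentation_mult)
    qed
    ultimately show "subalgebra ?S"
      using sub by (simp add: subalgebra_def A.subspace_def augmentation_add assms(1,3,4)
          augmentation_one augmentation_scaleA)
  qed
  then have "act 1 a = augmentation a" using assms(7) by blast
  then show ?thesis using act[OF assms(7), of z] by (simp only: triv_act_def)
qed

text \<open>The tensor product over \<^const>\<open>A_plus\<close>: the vector space freely spanned by the pairs
  \<open>(z, a)\<close>, standing for \<open>z \<otimes> a\<close>, modulo bilinearity and balancedness.\<close>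

abbreviation pair :: "complex \<Rightarrow> frakA \<Rightarrow> (complex \<times> frakA \<Rightarrow>\<^sub>0 complex)" where
  "pair z a \<equiv> Poly_Mapping.single (z, a) 1"

definition tensor_rels :: "(complex \<times> frakA \<Rightarrow>\<^sub>0 complex) set" where
  "tensor_rels =
     {pair (z + z') a - pair z a - pair z' a | z z' a. True} \<union>
     {pair z (a + a') - pair z a - pair z a' | z a a'. True} \<union>
     {pair (c * z) a - pm_scale c (pair z a) | c z a. True} \<union>
     {pair z (scaleA c a) - pm_scale c (pair z a) | c z a. True} \<union>
     {pair (triv_act z b) a - pair z (b * a) | z b a. b \<in> A_plus}"

definition tensor_rel ::
    "(complex \<times> frakA \<Rightarrow>\<^sub>0 complex) \<Rightarrow> (complex \<times> frakA \<Rightarrow>\<^sub>0 complex) \<Rightarrow> bool" where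
  "tensor_rel x y \<longleftrightarrow> x - y \<in> free_vs.span tensor_rels"

quotient_type frakM = "complex \<times> frakA \<Rightarrow>\<^sub>0 complex" / tensor_rel
proof (rule equivpI)
  show "reflp tensor_rel" by (rule reflpI) (simp add: tensor_rel_def free_vs.span_zero)
  show "symp tensor_rel"
    using free_vs.span_neg by (fastforce intro: sympI simp: tensor_rel_def)
  show "transp tensor_rel"
    using free_vs.span_add by (fastforce intro: transpI simp: tensor_rel_def)
qed

instantiation frakM :: ab_group_add
begin

lift_definition zero_frakM :: frakM is 0 .

lift_definition plus_frakM :: "frakM \<Rightarrow> frakM \<Rightarrow> frakM" is "(+)"
  unfolding tensor_rel_def by (drule (1) free_vs.span_add) (simp add: algebra_simps)

lift_definition uminus_frakM :: "frakM \<Rightarrow> frakM" is uminus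
  unfolding tensor_rel_def by (drule free_vs.span_neg) (simp add: algebra_simps)

lift_definition minus_frakM :: "frakM \<Rightarrow> frakM \<Rightarrow> frakM" is "(-)"
  unfolding tensor_rel_def by (drule (1) free_vs.span_diff) (simp add: algebra_simps)

instance
  by standard (transfer; simp add: tensor_rel_def free_vs.span_zero algebra_simps)+

end

lift_definition scaleM :: "complex \<Rightarrow> frakM \<Rightarrow> frakM" is pm_scale
  unfolding tensor_rel_def free_vs.scale_right_diff_distrib[symmetric] by (rule free_vs.span_scale)

global_interpretation M: vector_space scaleM
  by unfold_locales
    (transfer; simp add: tensor_rel_def free_vs.span_zero
       free_vs.scale_right_distrib free_vs.scale_left_distrib)+

lift_definition tensor :: "complex \<Rightarrow> frakA \<Rightarrow> frakM" is pair .

text \<open>The right action \<open>(z \<otimes> b) a = z \<otimes> (b a)\<close>, extended linearly.\<close>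

definition pair_act :: "(complex \<times> frakA \<Rightarrow>\<^sub>0 complex) \<Rightarrow> frakA \<Rightarrow> (complex \<times> frakA \<Rightarrow>\<^sub>0 complex)" where
  "pair_act x a = (\<Sum>p\<in>Poly_Mapping.keys x.
     pm_scale (Poly_Mapping.lookup x p) (pair (fst p) (snd p * a)))"

lemma pair_act_superset:
  assumes "finite K" "Poly_Mapping.keys x \<subseteq> K"
  shows "pair_act x a = (\<Sum>p\<in>K. pm_scale (Poly_Mapping.lookup x p) (pair (fst p) (snd p * a)))"
  unfolding pair_act_def
  by (rule sum.mono_neutral_left) (use assms in \<open>auto simp: in_keys_iff\<close>)

lemma pair_act_pair [simp]: "pair_act (pair z b) a = pair z (b * a)"
  by (simp add: pair_act_def)

lemma pair_act_add: "pair_act (x + y) a = pair_act x a + pair_act y a"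
proof -
  let ?K = "Poly_Mapping.keys x \<union> Poly_Mapping.keys y"
  have "Poly_Mapping.keys (x + y) \<subseteq> ?K" by (rule keys_add)
  then show ?thesis
    by (simp add: pair_act_superset[of ?K] lookup_add free_vs.scale_left_distrib sum.distrib)
qed

lemma pair_act_scale: "pair_act (pm_scale c x) a = pm_scale c (pair_act x a)"
proof -
  have "Poly_Mapping.keys (pm_scale c x) \<subseteq> Poly_Mapping.keys x" by (auto simp: in_keys_iff)
  then show ?thesis
    by (simp add: pair_act_superset[of "Poly_Mapping.keys x"] free_vs.scale_sum_right)
qed

lemma pair_act_diff: "pair_act (x - y) a = pair_act x a - pair_act y a"
  using pair_act_add[of "x - y" y a] by simp

lemma pair_act_tensor_rels:
  assumes "x \<in> free_vs.span tensor_rels"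
  shows "pair_act x a \<in> free_vs.span tensor_rels"
  using assms
proof (induction rule: free_vs.span_induct_alt)
  case base
  show ?case by (simp add: pair_act_def free_vs.span_zero)
next
  case (step c r y)
  have "pair_act r a \<in> tensor_rels"
    using step(1)[unfolded tensor_rels_def]
  proof (elim UnE CollectE exE conjE)
    fix z z' b assume "r = pair (z + z') b - pair z b - pair z' b"
    then have "pair_act r a = pair (z + z') (b * a) - pair z (b * a) - pair z' (b * a)"
      by (simp add: pair_act_diff)
    then show ?thesis unfolding tensor_rels_def by blast
  next
    fix z b b' assume "r = pair z (b + b') - pair z b - pair z b'"
    then have "pair_act r a = pair z (b * a + b' * a) - pair z (b * a) - pair z (b' * a)"
      by (simp add: pair_act_diff distrib_right)
    then show ?thesis unfolding tensor_rels_def by blast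
  next
    fix c z b assume "r = pair (c * z) b - pm_scale c (pair z b)"
    then have "pair_act r a = pair (c * z) (b * a) - pm_scale c (pair z (b * a))"
      by (simp add: pair_act_diff pair_act_scale)
    then show ?thesis unfolding tensor_rels_def by blast
  next
    fix c z b assume "r = pair z (scaleA c b) - pm_scale c (pair z b)"
    then have "pair_act r a = pair z (scaleA c (b * a)) - pm_scale c (pair z (b * a))"
      by (simp add: pair_act_diff pair_act_scale scaleA_mult_left)
    then show ?thesis unfolding tensor_rels_def by blast
  next
    fix z d b assume "r = pair (triv_act z d) b - pair z (d * b)" and d: "d \<in> A_plus"
    then have "pair_act r a = pair (triv_act z d) (b * a) - pair z (d * (b * a))"
      by (simp add: pair_act_diff mult.assoc)
    with d show ?thesis unfolding tensor_rels_def by blast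
  qed
  with step(2) show ?case
    by (simp add: pair_act_add pair_act_scale free_vs.span_add free_vs.span_scale free_vs.span_base)
qed

lift_definition act :: "frakM \<Rightarrow> frakA \<Rightarrow> frakM" is pair_act
  unfolding tensor_rel_def pair_act_diff[symmetric] by (rule pair_act_tensor_rels)

lemma act_tensor [simp]: "act (tensor z b) a = tensor z (b * a)"
  by transfer (simp add: tensor_rel_def free_vs.span_zero)

lemma act_add_left: "act (x + y) a = act x a + act y a"
  by transfer (simp add: tensor_rel_def free_vs.span_zero pair_act_add)

lemma act_scale_left: "act (scaleM c x) a = scaleM c (act x a)"
  by transfer (simp add: tensor_rel_def free_vs.span_zero pair_act_scale)

lemma act_zero_left: "act 0 a = 0"
  using act_add_left[of 0 0 a] by simp

lemma tensor_relI: "r \<in> tensor_rels \<Longrightarrow> x - y = r \<Longrightarrow> tensor_rel x y"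
  by (simp add: tensor_rel_def free_vs.span_base)

lemma tensor_add_left: "tensor (z + z') a = tensor z a + tensor z' a"
  by transfer (rule tensor_relI[OF _ refl], unfold tensor_rels_def diff_diff_eq[symmetric], blast)

lemma tensor_add_right: "tensor z (a + b) = tensor z a + tensor z b"
  by transfer (rule tensor_relI[OF _ refl], unfold tensor_rels_def diff_diff_eq[symmetric], blast)

lemma tensor_scale_left: "tensor (c * z) a = scaleM c (tensor z a)"
  by transfer (rule tensor_relI[OF _ refl], unfold tensor_rels_def, blast)

lemma tensor_scale_right: "tensor z (scaleA c a) = scaleM c (tensor z a)"
  by transfer (rule tensor_relI[OF _ refl], unfold tensor_rels_def, blast)

lemma tensor_balanced: "b \<in> A_plus \<Longrightarrow> tensor (triv_act z b) a = tensor z (b * a)"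
  by transfer (rule tensor_relI[OF _ refl], unfold tensor_rels_def, blast)

lemma frakM_induct [case_names zero add]:
  assumes "Q 0" "\<And>z a x. Q x \<Longrightarrow> Q (tensor z a + x)"
  shows "Q x"
proof (induction x rule: frakM.abs_induct)
  case (1 f)
  show ?case
  proof (induction f rule: update_induct)
    case const
    show ?case using assms(1) by (simp add: zero_frakM.abs_eq)
  next
    case (update f p c)
    obtain z a where p: "p = (z, a)" by (cases p)
    have "Poly_Mapping.update p c f = pm_scale c (pair z a) + f"
      using update(1) by (intro poly_mapping_eqI)
        (auto simp: p lookup_update lookup_add lookup_single when_def in_keys_iff)
    then have "abs_frakM (Poly_Mapping.update p c f) = tensor (c * z) a + abs_frakM f"
      unfolding tensor_scale_left by (simp add: tensor.abs_eq scaleM.abs_eq plus_frakM.abs_eq)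
    then show ?case using assms(2)[OF update(3)] by simp
  qed
qed

lemma act_one: "act x 1 = x"
  by (induction x rule: frakM_induct) (simp_all add: act_zero_left act_add_left)

lemma act_mult: "act x (a * b) = act (act x a) b"
  by (induction x rule: frakM_induct) (simp_all add: act_zero_left act_add_left mult.assoc)

lemma act_add_right: "act x (a + b) = act x a + act x b"
  by (induction x rule: frakM_induct)
    (simp_all add: act_zero_left act_add_left tensor_add_right algebra_simps)

lemma act_scale_right: "act x (scaleA c a) = scaleM c (act x a)"
  by (induction x rule: frakM_induct)
    (simp_all add: act_zero_left act_add_left scaleA_mult_right tensor_scale_right
      M.scale_right_distrib)

definition v :: frakM where
  "v = tensor 1 1"

lemma act_v_e: "i > 0 \<Longrightarrow> act v (e i) = 0"
proof -
  assume "i > 0"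
  then have "e i \<in> A_plus" unfolding A_plus_def by (intro hull_inc) auto
  from tensor_balanced[OF this, of 1 1] show ?thesis
    using tensor_scale_left[of 0 0 1] by (simp add: v_def triv_act_e)
qed


section \<open>The spaces P(n)\<close>

definition A_ge0 :: "frakA set" where
  "A_ge0 = A.span (e ` {0..})"

text \<open>The n-th tensor power of \<^const>\<open>A_ge0\<close> is spanned by the pure tensors
  \<open>a\<^sub>1 \<otimes> \<dots> \<otimes> a\<^sub>n\<close>, so the image of the linear map sending them to \<open>v a\<^sub>1 \<dots> a\<^sub>n\<close> is the
  span of these vectors. By \<open>P_eq_span_e\<close> below the \<open>a\<^sub>j\<close> may be restricted to generators.
  Beware that \<^const>\<open>M.dim\<close> is 0 on infinite-dimensional spaces; a positive value
  of it means that the dimension is finite.\<close>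

definition P :: "nat \<Rightarrow> frakM set" where
  "P n = M.span {foldl act v as | as. length as = n \<and> set as \<subseteq> A_ge0}"

lemma P_eq_span_e:
  "P n = M.span {foldl act v (map e is) | is. length is = n \<and> set is \<subseteq> {0..}}"
    (is "_ = M.span (?E n)")
proof
  have in_ge0: "set (map e is) \<subseteq> A_ge0" if "set is \<subseteq> {0..}" for "is"
    unfolding A_ge0_def using that by (auto intro!: A.span_base)
  show "M.span (?E n) \<subseteq> P n"
    unfolding P_def
  proof (rule M.span_mono, safe)
    fix js :: "int list" assume "set js \<subseteq> {0..}"
    from in_ge0[OF this]
    show "\<exists>as. foldl act v (map e js) = foldl act v as \<and> length as = length js \<and> set as \<subseteq> A_ge0"
      by (intro exI[of _ "map e js"]) simp
  qed
  have act_e: "act x (e i) \<in> M.span (?E (Suc n))" if x: "x \<in> M.span (?E n)" and "i \<ge> 0" for x n i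
    using x
  proof (induction rule: M.span_induct_alt)
    case base
    show ?case by (simp add: act_zero_left M.span_zero)
  next
    case (step c y z)
    from step(1) obtain js where js: "y = foldl act v (map e js)" "length js = n" "set js \<subseteq> {0..}"
      by blast
    then have "act y (e i) = foldl act v (map e (js @ [i]))" by simp
    moreover have "length (js @ [i]) = Suc n" "set (js @ [i]) \<subseteq> {0..}"
      using js \<open>i \<ge> 0\<close> by auto
    ultimately have "act y (e i) \<in> ?E (Suc n)" by blast
    then show ?case
      using step(2) by (simp add: act_add_left act_scale_left M.span_add M.span_scale M.span_base)
  qed
  have act_ge0: "act x a \<in> M.span (?E (Suc n))" if x: "x \<in> M.span (?E n)" and "a \<in> A_ge0" for x n a
    using that(2) unfolding A_ge0_def
  proof (induction rule: A.span_induct_alt)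
    case base
    show ?case using act_scale_right[of x 0 0] by (simp add: M.span_zero)
  next
    case (step c b b')
    then show ?case
      using act_e[OF x] by (auto simp: act_add_right act_scale_right intro!: M.span_add M.span_scale)
  qed
  have "foldl act v as \<in> M.span (?E (length as))" if "set as \<subseteq> A_ge0" for as
    using that
  proof (induction as rule: rev_induct)
    case Nil
    show ?case by (rule M.span_base) simp
  next
    case (snoc a as)
    then show ?case using act_ge0 by simp
  qed
  then show "P n \<subseteq> M.span (?E n)"
    unfolding P_def by (intro M.span_minimal M.subspace_span) blast
qed

end

theory Submission
  imports Defs "HOL-Library.Multiset"
begin

text \<open>
  Both bounds come from the words \<open>i\<^sub>1 \<dots> i\<^sub>n\<close> with \<open>i\<^sub>1 = 0\<close>, all letters nonnegative and
  \<open>i\<^sub>k\<^sub>+\<^sub>1 \<le> i\<^sub>k + 1\<close>: the vectors \<open>v e[i\<^sub>1] \<dots> e[i\<^sub>n]\<close> attached to them form a basis of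
  \<open>P n\<close>, and a ballot recursion counts them by the Catalan number.

  They span because the relation lets one replace \<open>e[i] e[j]\<close> with \<open>j \<ge> i + 2\<close> by
  \<open>e[i+1] e[j-1] + e[j-1] e[i+1] - e[j] e[i]\<close>. All new words keep nonnegative letters and
  have size moved to the left, so the process ends; words with positive first letter kill \<open>v\<close>
  (\<open>vec_in_span\<close>).

  For linear independence one needs enough linear functionals on the induced module. A functional
  on words of length \<open>n\<close> is a generating function \<open>F(u\<^sub>1, \<dots>, u\<^sub>n)\<close>, and the relations demand that
  \<open>F\<close> plus its image under the exchange of two neighbouring variables be a multiple of the formal
  delta function of their ratio. The functions
  \<open>s(u) / \<Prod>\<^sub>j\<^sub><\<^sub>k (u\<^sub>k - u\<^sub>j)\<close>, with \<open>s\<close> a symmetric power series and the fractions expanded for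
  \<open>\<bar>u\<^sub>1\<bar> < \<bar>u\<^sub>2\<bar> < \<dots>\<close>, have this property: exchanging two variables
  changes the sign and the region of expansion, and the two expansions of \<open>1 / (u - w)\<close> differ by
  a delta function. These are the correlation functions of the vertex operator of a lattice
  generated by a vector of square \<open>-1\<close>. Only nonnegative powers of \<open>u\<^sub>1\<close> occur; with
  \<open>e[i]\<close> dual to \<open>u\<^sup>-\<^sup>i\<close> this says that \<open>v e[i] = 0\<close> for \<open>i > 0\<close>. The coefficients
  are \<open>coeff_chain\<close>, and the relation is \<open>coeff_chain_relation\<close>.

  Writing \<open>i\<^sub>k = k - 1 - a\<^sub>k\<close> turns a word of the basis into a weakly increasing sequence \<open>a\<close>, that
  is, into a partition. Pairing the word of \<open>a\<close> with the monomial symmetric function of a partition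
  \<open>b\<close> gives a triangular matrix with nonzero diagonal, for the order by sum of squares of the
  parts (\<open>pairing_triangular\<close>).
\<close>

section \<open>Coefficients of symmetric functions divided by the Vandermonde product\<close>

definition below :: "nat list \<Rightarrow> nat list set" where
  "below M = {K. list_all2 (\<le>) K M}"

lemma below_Nil [simp]: "below [] = {[]}"
  by (auto simp: below_def)

lemma below_Cons: "below (m # M) = (\<lambda>(k, K). k # K) ` ({..m} \<times> below M)"
  by (auto simp: below_def list_all2_Cons2)

lemma finite_below [simp]: "finite (below M)"
  by (induction M) (simp_all add: below_Cons)

lemma sum_below_Cons: "(\<Sum>K\<in>below (m # M). f K) = (\<Sum>k\<le>m. \<Sum>K\<in>below M. f (k # K))"
proof -
  have "inj_on (\<lambda>(k, K). k # K) ({..m} \<times> below M)" by (auto simp: inj_on_def)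
  then show ?thesis
    by (simp add: below_Cons sum.reindex sum.cartesian_product case_prod_unfold)
qed

lemma length_below: "K \<in> below M \<Longrightarrow> length K = length M"
  by (simp add: below_def list_all2_lengthD)

lemma self_below [simp]: "M \<in> below M"
  by (simp add: below_def list_all2_refl)

lemma sum_list_below: "K \<in> below M \<Longrightarrow> sum_list K \<le> sum_list M"
  unfolding below_def mem_Collect_eq by (induction rule: list_all2_induct) auto

text \<open>The involution on the interval of exponent vectors between \<open>L\<close> and \<open>M\<close> that turns the order
  upside down.\<close>
definition reflect :: "nat list \<Rightarrow> nat list \<Rightarrow> nat list \<Rightarrow> nat list" where
  "reflect M L K = map2 (\<lambda>(m, l) k. m + l - k) (zip M L) K"

lemma below_reflect:
  assumes "K \<in> below M" "L \<in> below K"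
  shows "reflect M L K \<in> below M \<and> L \<in> below (reflect M L K) \<and>
    reflect M L (reflect M L K) = K \<and>
    sum_list (reflect M L K) + sum_list K = sum_list M + sum_list L"
proof -
  have "length K = length M" "length L = length K" using assms by (auto dest: length_below)
  then show ?thesis using assms
    unfolding below_def mem_Collect_eq reflect_def
    by (induction K M arbitrary: L rule: list_induct2) (auto simp: list_all2_Cons2)
qed

text \<open>The interval between \<open>L\<close> and \<open>M\<close> contains as many vectors at a given distance from the top as at
  the same distance from the bottom. This is what remains of the symmetry in two neighbouring
  variables of the factors that couple them to the earlier variables.\<close>
lemma sum_below_reflect:
  "(\<Sum>K\<in>below M. \<Sum>L\<in>below K. f (sum_list M - sum_list K) L) =
   (\<Sum>K\<in>below M. \<Sum>L\<in>below K. f (sum_list K - sum_list L) L)"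
proof -
  let ?S = "SIGMA K:below M. below K"
  let ?r = "\<lambda>(K, L). (reflect M L K, L)"
  have "(\<Sum>(K, L)\<in>?S. f (sum_list M - sum_list K) L) =
        (\<Sum>(K, L)\<in>?S. f (sum_list K - sum_list L) L)"
  proof (rule sum.reindex_bij_witness[of _ ?r ?r])
    fix p assume p: "p \<in> ?S"
    obtain K L where [simp]: "p = (K, L)" by (cases p)
    have KL: "K \<in> below M" "L \<in> below K" using p by auto
    note r = below_reflect[OF KL]
    show "?r (?r p) = p" "?r (?r p) = p" "?r p \<in> ?S" "?r p \<in> ?S" using r by auto
    have "sum_list (reflect M L K) - sum_list L = sum_list M - sum_list K"
      using r sum_list_below[OF KL(1)] by linarith
    then show "(case ?r p of (K, L) \<Rightarrow> f (sum_list K - sum_list L) L)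
      = (case p of (K, L) \<Rightarrow> f (sum_list M - sum_list K) L)" by simp
  qed
  then show ?thesis by (simp add: sum.Sigma)
qed

text \<open>The list \<open>M\<close> holds the exponents of the variables that precede the letters of \<open>w\<close>, most recent
  first; \<open>s\<close> gives the coefficients of a power series in all variables. The value is the coefficient
  of \<open>u\<^sup>M\<close> times \<open>u\<^sub>k\<close> to the power minus the letter, for each new variable \<open>u\<^sub>k\<close>, in \<open>s\<close> divided by
  the factors \<open>u\<^sub>k - u\<^sub>j\<close> with \<open>u\<^sub>k\<close> new and \<open>j < k\<close>. For one new variable \<open>u\<close>, each factor is
  \<open>1 / (u - u\<^sub>j) = u\<^sup>-\<^sup>1 (1 + u\<^sub>j / u + \<dots>)\<close>: passing from \<open>M\<close> to a smaller \<open>K\<close> takes powers of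
  \<open>u\<^sub>j / u\<close> out of the geometric series, and the leading \<open>u\<^sup>-\<^sup>1\<close> of all factors together account for
  the summand \<open>length M\<close>.\<close>
fun coeff_chain :: "(nat list \<Rightarrow> nat) \<Rightarrow> int list \<Rightarrow> nat list \<Rightarrow> nat" where
  "coeff_chain s [] M = s M"
| "coeff_chain s (i # w) M = (\<Sum>K\<in>below M.
     let p = int (length M) - i + int (sum_list M - sum_list K)
     in if p < 0 then 0 else coeff_chain s w (nat p # K))"

text \<open>Symmetry is stated for neighbouring transpositions, which is the form that survives an induction
  on the position.\<close>
definition swap_invariant :: "(nat list \<Rightarrow> nat) \<Rightarrow> bool" where
  "swap_invariant s \<longleftrightarrow> (\<forall>xs a b ys. s (xs @ a # b # ys) = s (xs @ b # a # ys))"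

lemma swap_invariant_Cons: "swap_invariant g \<Longrightarrow> swap_invariant (\<lambda>K. g (x # K))"
  unfolding swap_invariant_def by (metis append_Cons)

lemma sum_below_swap:
  assumes "swap_invariant g"
  shows "(\<Sum>K\<in>below (xs @ a # b # ys). g K) = (\<Sum>K\<in>below (xs @ b # a # ys). g K)"
  using assms
proof (induction xs arbitrary: g)
  case Nil
  have "g (k # l # K) = g (l # k # K)" for k l K
    using Nil by (metis swap_invariant_def append_Nil)
  then have "(\<Sum>k\<le>a. \<Sum>l\<le>b. \<Sum>K\<in>below ys. g (k # l # K))
      = (\<Sum>k\<le>a. \<Sum>l\<le>b. \<Sum>K\<in>below ys. g (l # k # K))" by simp
  also have "\<dots> = (\<Sum>l\<le>b. \<Sum>k\<le>a. \<Sum>K\<in>below ys. g (l # k # K))" by (rule sum.swap)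
  finally show ?case by (simp add: sum_below_Cons)
next
  case (Cons x xs)
  show ?case
    by (simp add: sum_below_Cons Cons.IH[OF swap_invariant_Cons[OF Cons.prems]])
qed

lemma swap_invariant_coeff_chain:
  assumes "swap_invariant s"
  shows "swap_invariant (coeff_chain s w)"
proof (induction w)
  case Nil
  show ?case using assms by (simp add: swap_invariant_def)
next
  case (Cons i w)
  define g where "g l t K = (let p = int l - i + int (t - sum_list K)
     in if p < 0 then 0 else coeff_chain s w (nat p # K))" for l t K
  have *: "coeff_chain s (i # w) M = (\<Sum>K\<in>below M. g (length M) (sum_list M) K)" for M
    by (simp only: coeff_chain.simps g_def)
  have "swap_invariant (g l t)" for l t
    unfolding swap_invariant_def
  proof (intro allI)
    fix us vs :: "nat list" and c d :: nat
    have sum: "sum_list (us @ c # d # vs) = sum_list (us @ d # c # vs)" by simp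
    have "coeff_chain s w (q # us @ c # d # vs) = coeff_chain s w (q # us @ d # c # vs)" for q
      using Cons[unfolded swap_invariant_def, THEN spec, of "q # us"] unfolding append_Cons by blast
    then show "g l t (us @ c # d # vs) = g l t (us @ d # c # vs)"
      unfolding g_def sum by presburger
  qed
  note swap = sum_below_swap[OF this]
  show ?case
    unfolding swap_invariant_def
  proof (intro allI)
    fix xs ys :: "nat list" and a b :: nat
    have "length (xs @ a # b # ys) = length (xs @ b # a # ys)"
      and "sum_list (xs @ a # b # ys) = sum_list (xs @ b # a # ys)" by simp_all
    then show "coeff_chain s (i # w) (xs @ a # b # ys) = coeff_chain s (i # w) (xs @ b # a # ys)"
      unfolding * by (simp only: swap[of _ _ xs a b ys])
  qed
qed

text \<open>Both new variables at once: their exponents \<open>p\<close> and \<open>C L - p\<close> have a sum that sees only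
  \<open>i + j\<close>, and the first letter enters only through the upper end of the range of \<open>p\<close>.\<close>
lemma coeff_chain_two:
  fixes s w M L i j
  defines "C \<equiv> \<lambda>L. int (2 * length M + 1) - (i + j) + int (sum_list M - sum_list L)"
  shows "coeff_chain s (i # j # w) M = (\<Sum>K\<in>below M. \<Sum>L\<in>below K.
     \<Sum>p\<in>{0..min (int (length M) - i + int (sum_list M - sum_list K)) (C L)}.
        coeff_chain s w (nat (C L - p) # nat p # L))"
proof -
  have *: "(let p = int (length M) - i + int (sum_list M - sum_list K)
     in if p < 0 then 0 else coeff_chain s (j # w) (nat p # K)) =
     (\<Sum>L\<in>below K.
     \<Sum>p\<in>{0..min (int (length M) - i + int (sum_list M - sum_list K)) (C L)}.
        coeff_chain s w (nat (C L - p) # nat p # L))" if K: "K \<in> below M" for K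
  proof -
    define y where "y = int (length M) - i + int (sum_list M - sum_list K)"
    show ?thesis
    proof (cases "y < 0")
      case True
      then show ?thesis by (simp add: y_def[symmetric] Let_def)
    next
      case False
      have inner: "(let q = int (length (nat y # K)) - j + int (sum_list (nat y # K) - sum_list (k # L))
            in if q < 0 then 0 else coeff_chain s w (nat q # k # L))
          = (if int k \<le> C L then coeff_chain s w (nat (C L - int k) # nat (int k) # L) else 0)"
        if "k \<le> nat y" "L \<in> below K" for k L
      proof -
        have "int (length (nat y # K)) - j + int (sum_list (nat y # K) - sum_list (k # L)) = C L - int k"
          using that False sum_list_below[OF K] sum_list_below[OF that(2)] length_below[OF K]
          unfolding C_def y_def by (simp add: of_nat_diff)
        then show ?thesis by (simp add: Let_def)
      qed
      have "coeff_chain s (j # w) (nat y # K) = (\<Sum>k\<le>nat y. \<Sum>L\<in>below K.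
           (if int k \<le> C L then coeff_chain s w (nat (C L - int k) # nat (int k) # L) else 0))"
        unfolding coeff_chain.simps sum_below_Cons using inner by (intro sum.cong refl) auto
      also have "\<dots> = (\<Sum>L\<in>below K. \<Sum>k\<le>nat y.
           (if int k \<le> C L then coeff_chain s w (nat (C L - int k) # nat (int k) # L) else 0))"
        by (rule sum.swap)
      also have "\<dots> = (\<Sum>L\<in>below K. \<Sum>k | k \<le> nat y \<and> int k \<le> C L.
            coeff_chain s w (nat (C L - int k) # nat (int k) # L))"
        by (simp add: sum.inter_filter[symmetric] atMost_def)
      also have "\<dots> = (\<Sum>L\<in>below K. \<Sum>p\<in>{0..min y (C L)}.
            coeff_chain s w (nat (C L - p) # nat p # L))"
        using False
        by (intro sum.cong refl sum.reindex_bij_witness[of _ nat int]) auto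
      finally show ?thesis using False unfolding y_def[symmetric] Let_def by simp
    qed
  qed
  show ?thesis
    unfolding coeff_chain.simps(2)[of s i] by (rule sum.cong[OF refl *])
qed

text \<open>For a sequence on \<open>{0..C}\<close> that is symmetric under \<open>p \<mapsto> C - p\<close>, an initial segment and the
  mirror image of the complementary one make up the whole. This expresses on coefficients
  that the two expansions of \<open>1 / (u - w)\<close> differ by a delta function.\<close>
lemma half_sums:
  fixes \<gamma> :: "int \<Rightarrow> nat"
  assumes "\<And>p. 0 \<le> p \<Longrightarrow> p \<le> C \<Longrightarrow> \<gamma> (C - p) = \<gamma> p"
  shows "(\<Sum>p\<in>{0..min y C}. \<gamma> p) + (\<Sum>p\<in>{0..min (C - 1 - y) C}. \<gamma> p) = (\<Sum>p\<in>{0..C}. \<gamma> p)"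
proof -
  have "(\<Sum>p\<in>{0..min (C - 1 - y) C}. \<gamma> p) = (\<Sum>p\<in>{max (y + 1) 0..C}. \<gamma> p)"
    using assms by (intro sum.reindex_bij_witness[of _ "\<lambda>p. C - p" "\<lambda>p. C - p"]) auto
  moreover have "{0..C} = {0..min y C} \<union> {max (y + 1) 0..C}" by auto
  ultimately show ?thesis by (simp add: sum.union_disjoint)
qed

text \<open>After reflecting the intermediate exponents in one of the two summands, the two ranges of \<open>p\<close>
  complement each other, so the sum sees \<open>i\<close> and \<open>j\<close> only through \<open>i + j\<close>.\<close>
lemma coeff_chain_anticomm:
  fixes s w M i j
  assumes "swap_invariant s"
  defines "C \<equiv> \<lambda>L. int (2 * length M + 1) - (i + j) + int (sum_list M - sum_list L)"
  shows "coeff_chain s (i # j # w) M + coeff_chain s (j # i # w) M =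
    (\<Sum>K\<in>below M. \<Sum>L\<in>below K. \<Sum>p\<in>{0..C L}. coeff_chain s w (nat (C L - p) # nat p # L))"
proof -
  let ?\<gamma> = "\<lambda>L p. coeff_chain s w (nat (C L - p) # nat p # L)"
  have sym: "?\<gamma> L (C L - p) = ?\<gamma> L p" for L p
    using swap_invariant_coeff_chain[OF assms(1), of w]
    by (simp add: swap_invariant_def) (metis append_Nil)
  have "coeff_chain s (j # i # w) M = (\<Sum>K\<in>below M. \<Sum>L\<in>below K.
     \<Sum>p\<in>{0..min (int (length M) - j + int (sum_list M - sum_list K)) (C L)}. ?\<gamma> L p)"
    unfolding coeff_chain_two C_def add.commute[of j i] ..
  also have "\<dots> = (\<Sum>K\<in>below M. \<Sum>L\<in>below K.
     \<Sum>p\<in>{0..min (int (length M) - j + int (sum_list K - sum_list L)) (C L)}. ?\<gamma> L p)"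
    by (rule sum_below_reflect[of "\<lambda>t L.
     \<Sum>p\<in>{0..min (int (length M) - j + int t) (C L)}. ?\<gamma> L p"])
  also have "\<dots> = (\<Sum>K\<in>below M. \<Sum>L\<in>below K.
     \<Sum>p\<in>{0..min (C L - 1 - (int (length M) - i + int (sum_list M - sum_list K))) (C L)}. ?\<gamma> L p)"
  proof (intro sum.cong refl)
    fix K L assume KL: "K \<in> below M" "L \<in> below K"
    then have "int (length M) - j + int (sum_list K - sum_list L) =
        C L - 1 - (int (length M) - i + int (sum_list M - sum_list K))"
      using sum_list_below[OF KL(1)] sum_list_below[OF KL(2)] unfolding C_def by (simp add: of_nat_diff)
    then show "{0..min (int (length M) - j + int (sum_list K - sum_list L)) (C L)} =
      {0..min (C L - 1 - (int (length M) - i + int (sum_list M - sum_list K))) (C L)}"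
      by (simp only:)
  qed
  finally have ji: "coeff_chain s (j # i # w) M = \<dots>" .
  have ij: "coeff_chain s (i # j # w) M = (\<Sum>K\<in>below M. \<Sum>L\<in>below K.
     \<Sum>p\<in>{0..min (int (length M) - i + int (sum_list M - sum_list K)) (C L)}. ?\<gamma> L p)"
    unfolding coeff_chain_two C_def ..
  show ?thesis
    unfolding ij ji sum.distrib[symmetric]
    by (rule sum.cong[OF refl], rule sum.cong[OF refl], rule half_sums[where \<gamma> = "?\<gamma> _"], rule sym)
qed

lemma coeff_chain_relation:
  assumes "swap_invariant s"
  shows "coeff_chain s (u @ i # j # w) M + coeff_chain s (u @ j # i # w) M =
    coeff_chain s (u @ (i + 1) # (j - 1) # w) M + coeff_chain s (u @ (j - 1) # (i + 1) # w) M"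
proof (induction u arbitrary: M)
  case Nil
  show ?case using coeff_chain_anticomm[OF assms, of i j w M] coeff_chain_anticomm[OF assms, of "i + 1" "j - 1" w M]
    by (simp del: coeff_chain.simps)
next
  case (Cons a u)
  then show ?case
    by (auto simp: sum.distrib[symmetric] Let_def intro!: sum.cong)
qed

section \<open>Triangularity of the pairing\<close>

text \<open>With \<open>k = 0\<close> these are the words indexing the basis; the parameter bounds the first letter and
  makes the set accessible to recursion.\<close>
fun slow_growth :: "int \<Rightarrow> int list \<Rightarrow> bool" where
  "slow_growth k [] \<longleftrightarrow> True"
| "slow_growth k (i # w) \<longleftrightarrow> 0 \<le> i \<and> i \<le> k \<and> slow_growth (i + 1) w"

text \<open>The sequence \<open>a\<^sub>k = k - 1 - i\<^sub>k\<close> attached to a word whose first letter has \<open>m\<close> predecessors. On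
  words of slow growth the truncation to natural numbers is harmless and \<open>a\<close> is weakly increasing.\<close>
fun exponents :: "nat \<Rightarrow> int list \<Rightarrow> nat list" where
  "exponents m [] = []"
| "exponents m (i # w) = nat (int m - i) # exponents (Suc m) w"

lemma length_exponents [simp]: "length (exponents m w) = length w"
  by (induction w arbitrary: m) auto

lemma sorted_exponents:
  assumes "slow_growth k w" "k \<le> int m"
  shows "sorted (exponents m w) \<and> (\<forall>x\<in>set (exponents m w). int m - k \<le> int x)"
  using assms
proof (induction w arbitrary: k m)
  case (Cons i w)
  have "sorted (exponents (Suc m) w) \<and> (\<forall>x\<in>set (exponents (Suc m) w). int (Suc m) - (i + 1) \<le> int x)"
    using Cons.prems by (intro Cons.IH) auto
  then show ?case using Cons.prems by fastforce
qed simp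

lemma exponents_inject:
  assumes "slow_growth k w" "k \<le> int m" "slow_growth k' w'" "k' \<le> int m"
    and "exponents m w = exponents m w'"
  shows "w = w'"
  using assms
proof (induction w arbitrary: w' k k' m)
  case Nil
  then show ?case by (cases w') auto
next
  case (Cons i w)
  then obtain i' u where w': "w' = i' # u" by (cases w') auto
  have "i \<le> int m" "i' \<le> int m" "nat (int m - i) = nat (int m - i')" using Cons.prems w' by simp_all
  then have "i = i'" by linarith
  moreover have "w = u"
    by (rule Cons.IH[of "i + 1" "Suc m" "i' + 1"]) (use Cons.prems w' in simp_all)
  ultimately show ?case using w' by simp
qed

definition dot :: "nat list \<Rightarrow> nat list \<Rightarrow> nat" where
  "dot A B = sum_list (map2 (*) A B)"

lemma dot_simps [simp]: "dot [] [] = 0" "dot (a # A) (b # B) = a * b + dot A B"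
  by (simp_all add: dot_def)

lemma dot_self: "dot A A = (\<Sum>x\<in>#mset A. x * x)"
  by (induction A) auto

text \<open>Moving \<open>M\<close> down to \<open>K\<close> and giving the removed amount to a new slot whose weight dominates all
  others does not decrease the weighted sum.\<close>
lemma dot_below:
  assumes "K \<in> below M" "length A = length M" "\<forall>x\<in>set A. x \<le> a"
  shows "dot A M \<le> dot A K + a * (sum_list M - sum_list K)"
proof -
  have "dot A M + a * sum_list K \<le> dot A K + a * sum_list M"
    using assms unfolding below_def mem_Collect_eq
  proof (induction K M arbitrary: A rule: list_all2_induct)
    case (Cons k K m M)
    then obtain x A' where A: "A = x # A'" "x \<le> a" by (cases A) auto
    obtain c where c: "m = k + c" using \<open>k \<le> m\<close> le_Suc_ex by blast
    have "x * c \<le> a * c" using A by simp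
    moreover have "dot A' M + a * sum_list K \<le> dot A' K + a * sum_list M"
      using Cons.prems A by (intro Cons.IH) auto
    ultimately have "x * c + (dot A' M + a * sum_list K) \<le> a * c + (dot A' K + a * sum_list M)"
      by (rule add_mono)
    then show ?case by (simp add: A c distrib_left)
  qed simp
  then show ?thesis using sum_list_below[OF assms(1)] by (simp add: diff_mult_distrib2)
qed

lemma two_dot_le:
  assumes "length A = length B"
  shows "2 * dot A B \<le> dot A A + dot B B \<and> (2 * dot A B = dot A A + dot B B \<longrightarrow> A = B)"
  using assms
proof (induction A B rule: list_induct2)
  case (Cons a A b B)
  have "int (2 * (a * b)) \<le> int (a * a + b * b) \<and> (int (2 * (a * b)) = int (a * a + b * b) \<longrightarrow> a = b)"
  proof -
    have "int (a * a + b * b) - int (2 * (a * b)) = (int a - int b)\<^sup>2"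
      by (simp add: power2_eq_square algebra_simps)
    moreover have "(int a - int b)\<^sup>2 \<ge> 0" "(int a - int b)\<^sup>2 = 0 \<longleftrightarrow> a = b" by auto
    ultimately show ?thesis by linarith
  qed
  then have ab: "2 * (a * b) \<le> a * a + b * b" "2 * (a * b) = a * a + b * b \<Longrightarrow> a = b"
    unfolding of_nat_le_iff of_nat_eq_iff by blast+
  have eq: "p = q \<and> r = t" if "p \<le> q" "r \<le> t" "p + r = q + t" for p q r t :: nat
    using that by linarith
  have lhs: "2 * dot (a # A) (b # B) = 2 * (a * b) + 2 * dot A B"
    and rhs: "dot (a # A) (a # A) + dot (b # B) (b # B) = (a * a + b * b) + (dot A A + dot B B)"
    by simp_all
  show ?case
    unfolding lhs rhs
  proof (intro conjI impI)
    show "2 * (a * b) + 2 * dot A B \<le> (a * a + b * b) + (dot A A + dot B B)"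
      using ab(1) Cons.IH by (intro add_mono) blast+
    assume "2 * (a * b) + 2 * dot A B = (a * a + b * b) + (dot A A + dot B B)"
    from eq[OF ab(1) _ this] show "a # A = b # B" using ab(2) Cons.IH by blast
  qed
qed simp

text \<open>Under the hypotheses the sum of the squares of the differences is at most \<open>0\<close>.\<close>
lemma eq_if_dot_ge:
  assumes "length A = length B" "dot A A \<le> dot A B" "dot B B \<le> dot A A"
  shows "A = B"
  using two_dot_le[OF assms(1)] assms(2,3) by linarith

text \<open>Every exponent list \<open>B\<close> of \<open>s\<close> that contributes arises from the exponents of the word by
  transfers from earlier to later variables. Since these exponents increase, used as weights they
  favour the later variables, so that no transfer lowers the sum weighted by them
  (\<open>dot_below\<close>). The weights \<open>A\<close> stand for the part of the word already read.\<close>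
lemma coeff_chain_supportE:
  assumes "coeff_chain s w M \<noteq> 0" "slow_growth k w" "k \<le> int (length M)"
    and "length A = length M" "\<forall>x\<in>set A. int x \<le> int (length M) - k"
  obtains B where "s B \<noteq> 0" "length B = length w + length M"
    and "dot A M + dot (exponents (length M) w) (exponents (length M) w)
       \<le> dot (rev (exponents (length M) w) @ A) B"
proof -
  have "\<exists>B. s B \<noteq> 0 \<and> length B = length w + length M \<and>
    dot A M + dot (exponents (length M) w) (exponents (length M) w)
       \<le> dot (rev (exponents (length M) w) @ A) B"
    using assms
  proof (induction w arbitrary: M A k)
    case (Cons i w)
    from Cons.prems(1) obtain K where K: "K \<in> below M"
      and nz: "(let p = int (length M) - i + int (sum_list M - sum_list K)
        in if p < 0 then 0 else coeff_chain s w (nat p # K)) \<noteq> 0"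
      unfolding coeff_chain.simps by (rule sum.not_neutral_contains_not_neutral)
    define a where "a = nat (int (length M) - i)"
    define d where "d = sum_list M - sum_list K"
    have i: "0 \<le> i" "i \<le> k" "slow_growth (i + 1) w" using Cons.prems by auto
    have a: "int a = int (length M) - i" using Cons.prems i by (simp add: a_def)
    have nz': "coeff_chain s w ((a + d) # K) \<noteq> 0"
    proof -
      have "nat (int (length M) - i + int d) = a + d" using a by linarith
      then show ?thesis using nz by (simp add: d_def Let_def split: if_splits)
    qed
    have A: "\<forall>x\<in>set A. x \<le> a" using Cons.prems(5) i a by fastforce
    have len: "length K = length M" using K by (rule length_below)
    have "\<exists>B. s B \<noteq> 0 \<and> length B = length w + length ((a + d) # K) \<and>
      dot (a # A) ((a + d) # K) + dot (exponents (length ((a + d) # K)) w) (exponents (length ((a + d) # K)) w)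
       \<le> dot (rev (exponents (length ((a + d) # K)) w) @ a # A) B"
      using nz' i a A Cons.prems(3,4) len by (intro Cons.IH[of _ "i + 1"]) auto
    then obtain B where B: "s B \<noteq> 0" "length B = Suc (length w + length M)"
      "a * (a + d) + dot A K + dot (exponents (Suc (length M)) w) (exponents (Suc (length M)) w)
       \<le> dot (rev (exponents (Suc (length M)) w) @ a # A) B"
      using len by auto
    moreover have "dot A M \<le> dot A K + a * d"
      unfolding d_def using dot_below[OF K Cons.prems(4) A] .
    ultimately show ?case by (intro exI[of _ B]) (auto simp: a_def[symmetric] distrib_left)
  qed auto
  then show ?thesis using that by blast
qed

text \<open>The summand without any transfer, \<open>K = M\<close> at each step, already contributes.\<close>
lemma coeff_chain_ge:
  assumes "slow_growth k w" "k \<le> int (length M)"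
  shows "s (rev (exponents (length M) w) @ M) \<le> coeff_chain s w M"
  using assms
proof (induction w arbitrary: k M)
  case (Cons i w)
  let ?a = "nat (int (length M) - i)"
  have "s (rev (exponents (length (?a # M)) w) @ ?a # M) \<le> coeff_chain s w (?a # M)"
    using Cons.prems by (intro Cons.IH[of "i + 1"]) auto
  also have "\<dots> = (let p = int (length M) - i + int (sum_list M - sum_list M)
     in if p < 0 then 0 else coeff_chain s w (nat p # M))"
    using Cons.prems by simp
  also have "\<dots> \<le> coeff_chain s (i # w) M"
    unfolding coeff_chain.simps by (rule member_le_sum) auto
  finally show ?case by simp
qed simp

definition monomial_symmetric :: "nat multiset \<Rightarrow> nat list \<Rightarrow> nat" where
  "monomial_symmetric \<mu> M = (if mset M = \<mu> then 1 else 0)"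

lemma swap_invariant_monomial_symmetric: "swap_invariant (monomial_symmetric \<mu>)"
  by (simp add: swap_invariant_def monomial_symmetric_def add_mset_commute)

text \<open>The functional attached to \<open>u\<close>, evaluated at the word \<open>w\<close>: the symmetric function is the monomial
  one of the partition of \<open>u\<close>.\<close>
definition pairing :: "int list \<Rightarrow> int list \<Rightarrow> nat" where
  "pairing u w = coeff_chain (monomial_symmetric (mset (exponents 0 u))) w []"

lemma pairing_self:
  assumes "slow_growth 0 w" shows "pairing w w \<noteq> 0"
  using coeff_chain_ge[OF assms, of "[]" "monomial_symmetric (mset (exponents 0 w))"]
  by (simp add: pairing_def monomial_symmetric_def)

definition energy :: "int list \<Rightarrow> nat" where
  "energy w = dot (exponents 0 w) (exponents 0 w)"

text \<open>If the partition \<open>b\<close> of \<open>u\<close>, in some arrangement, contributes to the word with exponents \<open>a\<close>, then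
  \<open>\<Sum> a\<^sub>k b\<^sub>k \<ge> \<Sum> a\<^sub>k\<^sup>2\<close>, and \<open>\<Sum> b\<^sub>k\<^sup>2 \<le> \<Sum> a\<^sub>k\<^sup>2\<close> leaves only \<open>a = b\<close>.\<close>
lemma pairing_triangular:
  assumes u: "slow_growth 0 u" and w: "slow_growth 0 w"
    and "pairing u w \<noteq> 0" "energy u \<le> energy w"
  shows "u = w"
proof -
  let ?E = "exponents 0"
  obtain B where s: "monomial_symmetric (mset (?E u)) B \<noteq> 0" and B: "length B = length w"
    "dot (?E w) (?E w) \<le> dot (rev (?E w)) B"
  proof (rule coeff_chain_supportE[of "monomial_symmetric (mset (?E u))" w "[]" 0 "[]"])
    show "coeff_chain (monomial_symmetric (mset (?E u))) w [] \<noteq> 0"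
      using assms(3) unfolding pairing_def .
  qed (use w in simp_all)
  from s have mset: "mset B = mset (?E u)"
    by (simp add: monomial_symmetric_def split: if_splits)
  have "rev (?E w) = B"
  proof (rule eq_if_dot_ge)
    show "dot (rev (?E w)) (rev (?E w)) \<le> dot (rev (?E w)) B"
      using B(2) by (simp add: dot_self)
    show "dot B B \<le> dot (rev (?E w)) (rev (?E w))"
      using assms(4) by (simp add: dot_self energy_def mset)
  qed (use B in simp)
  then have "mset (?E w) = mset (?E u)" using mset by (metis mset_rev)
  moreover have "sorted (?E w)" "sorted (?E u)"
    using sorted_exponents[OF w, of 0] sorted_exponents[OF u, of 0] by auto
  ultimately have "?E w = ?E u"
    using properties_for_sort[of "?E w" "?E u"] sorted_sort_id[of "?E u"] by simp
  then show ?thesis using exponents_inject[OF w _ u, of 0] by simp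
qed

section \<open>Linear functionals on the induced module\<close>

definition linear_extension :: "('k \<Rightarrow> complex) \<Rightarrow> ('k \<Rightarrow>\<^sub>0 complex) \<Rightarrow> complex" where
  "linear_extension g x = (\<Sum>k\<in>Poly_Mapping.keys x. Poly_Mapping.lookup x k * g k)"

lemma linear_extension_superset:
  assumes "finite K" "Poly_Mapping.keys x \<subseteq> K"
  shows "linear_extension g x = (\<Sum>k\<in>K. Poly_Mapping.lookup x k * g k)"
  unfolding linear_extension_def
  by (rule sum.mono_neutral_left) (use assms in \<open>auto simp: in_keys_iff\<close>)

lemma linear_extension_add: "linear_extension g (x + y) = linear_extension g x + linear_extension g y"
proof -
  let ?K = "Poly_Mapping.keys x \<union> Poly_Mapping.keys y"
  have "Poly_Mapping.keys (x + y) \<subseteq> ?K" by (rule keys_add)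
  then show ?thesis
    by (simp add: linear_extension_superset[of ?K] lookup_add distrib_right sum.distrib)
qed

lemma linear_extension_scale: "linear_extension g (pm_scale c x) = c * linear_extension g x"
proof -
  have "Poly_Mapping.keys (pm_scale c x) \<subseteq> Poly_Mapping.keys x" by (auto simp: in_keys_iff)
  then show ?thesis
    by (simp add: linear_extension_superset[of "Poly_Mapping.keys x"] sum_distrib_left mult.assoc)
qed

lemma linear_extension_zero [simp]: "linear_extension g 0 = 0"
  by (simp add: linear_extension_def)

lemma linear_extension_diff: "linear_extension g (x - y) = linear_extension g x - linear_extension g y"
  using linear_extension_add[of g "x - y" y] by simp

lemma linear_extension_single [simp]: "linear_extension g (Poly_Mapping.single k c) = c * g k"
  by (cases "c = 0") (simp_all add: linear_extension_def)

lemma poly_mapping_single_induct [case_names zero add]: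
  assumes "Q 0" "\<And>k c x. Q x \<Longrightarrow> Q (Poly_Mapping.single k c + x)"
  shows "Q (x :: 'k \<Rightarrow>\<^sub>0 complex)"
proof (induction x rule: update_induct)
  case const
  show ?case by (rule assms(1))
next
  case (update f a b)
  have "Poly_Mapping.update a b f = Poly_Mapping.single a b + f"
    using update(1) by (intro poly_mapping_eqI)
      (auto simp: lookup_update lookup_add lookup_single when_def in_keys_iff)
  then show ?case using assms(2)[OF update(3)] by simp
qed

definition letter_relation :: "(int list \<Rightarrow> complex) \<Rightarrow> bool" where
  "letter_relation f \<longleftrightarrow> (\<forall>u i j w. f (u @ i # j # w) + f (u @ j # i # w) =
     f (u @ (i + 1) # (j - 1) # w) + f (u @ (j - 1) # (i + 1) # w))"

definition word_functional :: "(int list \<Rightarrow> complex) \<Rightarrow> free_alg \<Rightarrow> complex" where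
  "word_functional f = linear_extension (\<lambda>u. f (letters u))"

text \<open>The elements \<open>x\<close> such that the functional vanishes on all \<open>a * x * b\<close> form an ideal, so only the
  defining relations between two monomials have to be tested.\<close>
lemma word_functional_rel_ideal:
  assumes f: "letter_relation f" and x: "x \<in> rel_ideal"
  shows "word_functional f x = 0"
proof -
  note lin = word_functional_def linear_extension_add linear_extension_diff
  let ?J = "{x. \<forall>a b. word_functional f (a * x * b) = 0}"
  have "rel_ideal \<subseteq> ?J"
    unfolding rel_ideal_def
  proof (rule hull_minimal)
    show "two_sided_ideal ?J"
      unfolding two_sided_ideal_def
    proof (intro conjI ballI allI)
      show "0 \<in> ?J" by (simp add: word_functional_def)
      show "x + y \<in> ?J" if "x \<in> ?J" "y \<in> ?J" for x y
        using that by (simp add: lin distrib_left distrib_right)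
      fix x r assume "x \<in> ?J"
      then have *: "word_functional f (a * x * b) = 0" for a b by blast
      show "r * x \<in> ?J" using *[of "_ * r"] by (simp add: mult.assoc)
      show "x * r \<in> ?J" using *[of _ "r * _"] by (simp add: mult.assoc)
    qed
    show "{anticomm (gen i) (gen j) - anticomm (gen (i + 1)) (gen (j - 1)) | i j. True} \<subseteq> ?J"
    proof clarify
      fix i j a b
      let ?r = "anticomm (gen i) (gen j) - anticomm (gen (i + 1)) (gen (j - 1))"
      have mon: "word_functional f (Poly_Mapping.single k c * ?r * Poly_Mapping.single l d) = 0" for k c l d
      proof -
        have "Poly_Mapping.single k c * ?r * Poly_Mapping.single l d =
            Poly_Mapping.single (Word (letters k @ i # j # letters l)) (c * d)
          + Poly_Mapping.single (Word (letters k @ j # i # letters l)) (c * d)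
          - Poly_Mapping.single (Word (letters k @ (i + 1) # (j - 1) # letters l)) (c * d)
          - Poly_Mapping.single (Word (letters k @ (j - 1) # (i + 1) # letters l)) (c * d)"
          by (simp add: anticomm_def gen_def distrib_left distrib_right right_diff_distrib
              left_diff_distrib mult_single plus_free_word_def)
        then have eq: "word_functional f (Poly_Mapping.single k c * ?r * Poly_Mapping.single l d) =
          c * d * ((f (letters k @ i # j # letters l) + f (letters k @ j # i # letters l))
           - (f (letters k @ (i + 1) # (j - 1) # letters l) + f (letters k @ (j - 1) # (i + 1) # letters l)))"
          by (simp only: lin linear_extension_single free_word.sel) (simp add: algebra_simps)
        show ?thesis unfolding eq using f unfolding letter_relation_def by simp
      qed
      show "word_functional f (a * ?r * b) = 0"
      proof (induction b rule: poly_mapping_single_induct)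
        case (add l d b)
        have "word_functional f (a * ?r * Poly_Mapping.single l d) = 0"
          by (induction a rule: poly_mapping_single_induct)
            (simp_all add: lin distrib_right mon[unfolded word_functional_def])
        then show ?case using add by (simp add: lin distrib_left)
      qed (simp add: word_functional_def)
    qed
  qed
  then have "word_functional f (1 * x * 1) = 0" using x by blast
  then show ?thesis by simp
qed

lemma prod_list_e: "prod_list (map e w) = abs_frakA (Poly_Mapping.single (Word w) 1)"
proof (induction w)
  case Nil
  show ?case by (simp add: one_frakA.abs_eq flip: single_one zero_free_word_def)
next
  case (Cons i w)
  then show ?case
    by (simp add: e.abs_eq times_frakA.abs_eq gen_def mult_single plus_free_word_def)
qed

lemma foldl_act_tensor: "foldl act (tensor z a) as = tensor z (a * prod_list as)"
  by (induction as arbitrary: a) (simp_all add: mult.assoc)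

lemma functional_on_algebra:
  assumes f: "letter_relation f"
  obtains \<phi> :: "frakA \<Rightarrow> complex" where
    "\<And>x y. \<phi> (x + y) = \<phi> x + \<phi> y" "\<And>c x. \<phi> (scaleA c x) = c * \<phi> x"
    "\<And>x. \<phi> (abs_frakA x) = word_functional f x"
proof
  define \<phi> where "\<phi> a = word_functional f (rep_frakA a)" for a
  show abs: "\<phi> (abs_frakA x) = word_functional f x" for x
  proof -
    have "alg_rel (rep_frakA (abs_frakA x)) x"
      using Quotient3_abs_rep[OF Quotient3_frakA] by (simp flip: frakA.abs_eq_iff)
    then have "word_functional f (rep_frakA (abs_frakA x) - x) = 0"
      unfolding alg_rel_def by (rule word_functional_rel_ideal[OF f])
    then show ?thesis by (simp add: \<phi>_def word_functional_def linear_extension_diff)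
  qed
  show "\<phi> (x + y) = \<phi> x + \<phi> y" for x y
  proof (induction x rule: frakA.abs_induct, induction y rule: frakA.abs_induct)
    case (1 x y)
    show ?case
      by (simp add: plus_frakA.abs_eq abs word_functional_def linear_extension_add)
  qed
  show "\<phi> (scaleA c x) = c * \<phi> x" for c x
  proof (induction x rule: frakA.abs_induct)
    case (1 x)
    show ?case
      by (simp add: scaleA.abs_eq abs word_functional_def linear_extension_scale)
  qed
qed

text \<open>Vanishing on the right ideals generated by the positive generators makes a functional compatible
  with the trivial character of the positive subalgebra, as balancedness of the tensor product
  requires.\<close>
lemma functional_A_plus:
  assumes add: "\<And>x y. \<phi> (x + y) = \<phi> x + \<phi> y"
    and scale: "\<And>c x. \<phi> (scaleA c x) = c * \<phi> x"
    and e: "\<And>i x. i > 0 \<Longrightarrow> \<phi> (e i * x) = 0"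
    and b: "b \<in> A_plus"
  shows "\<phi> (b * x) = augmentation b * \<phi> x"
proof -
  let ?S = "{b. \<forall>x. \<phi> (b * x) = augmentation b * \<phi> x}"
  have zero: "\<phi> 0 = 0" "augmentation 0 = 0"
    using scale[of 0 0] augmentation_scaleA[of 0 0] by simp_all
  have "A_plus \<subseteq> ?S"
    unfolding A_plus_def
  proof (rule hull_minimal)
    show "e ` {0<..} \<subseteq> ?S" by (auto simp: e augmentation_e)
    show "subalgebra ?S"
      by (auto simp: subalgebra_def A.subspace_def zero add scale distrib_right scaleA_mult_left
          augmentation_add augmentation_scaleA augmentation_one augmentation_mult mult.assoc)
  qed
  then show ?thesis using b by blast
qed

text \<open>The universal property of the induced module for functionals: a function of words that respects
  the relations and vanishes on words starting with a positive letter is a linear functional.\<close>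
lemma functional_on_module:
  assumes f: "letter_relation f" and vac: "\<And>i w. i > 0 \<Longrightarrow> f (i # w) = 0"
  obtains \<psi> :: "frakM \<Rightarrow> complex" where
    "\<And>x y. \<psi> (x + y) = \<psi> x + \<psi> y" "\<And>c x. \<psi> (scaleM c x) = c * \<psi> x"
    "\<And>w. \<psi> (foldl act v (map e w)) = f w"
proof -
  obtain \<phi> where add: "\<And>x y. \<phi> (x + y) = \<phi> x + \<phi> y"
    and scale: "\<And>c x. \<phi> (scaleA c x) = c * \<phi> x"
    and abs: "\<And>x. \<phi> (abs_frakA x) = word_functional f x"
    using functional_on_algebra[OF f] by blast
  have "\<phi> (e i * x) = 0" if "i > 0" for i x
  proof (induction x rule: frakA.abs_induct)
    case (1 y)
    have "word_functional f (gen i * y) = 0"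
    proof (induction y rule: poly_mapping_single_induct)
      case (add k c y)
      then show ?case
        using vac[OF that]
        by (simp add: word_functional_def distrib_left linear_extension_add gen_def mult_single
            plus_free_word_def)
    qed (simp add: word_functional_def)
    then show ?case by (simp add: e.abs_eq times_frakA.abs_eq abs)
  qed
  from functional_A_plus[OF add scale this]
  have plus: "\<phi> (b * x) = augmentation b * \<phi> x" if "b \<in> A_plus" for b x
    using that by blast
  let ?l = "linear_extension (\<lambda>(z, a). z * \<phi> a)"
  have rels: "?l r = 0" if "r \<in> free_vs.span tensor_rels" for r
    using that
  proof (induction rule: free_vs.span_induct_alt)
    case (step c r y)
    have "?l r = 0"
      using step(1) unfolding tensor_rels_def
      by (elim UnE CollectE exE conjE; hypsubst)
        (simp_all add: linear_extension_add linear_extension_diff linear_extension_scale add scale plus triv_act_def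
          algebra_simps)
    then show ?case using step(2) by (simp add: linear_extension_add linear_extension_scale)
  qed simp
  define \<psi> where "\<psi> x = ?l (rep_frakM x)" for x
  have abs_M: "\<psi> (abs_frakM x) = ?l x" for x
  proof -
    have "tensor_rel (rep_frakM (abs_frakM x)) x"
      using Quotient3_abs_rep[OF Quotient3_frakM] by (simp flip: frakM.abs_eq_iff)
    then have "?l (rep_frakM (abs_frakM x) - x) = 0"
      unfolding tensor_rel_def by (rule rels)
    then show ?thesis by (simp add: \<psi>_def linear_extension_diff)
  qed
  show ?thesis
  proof (rule that[of \<psi>])
    show "\<psi> (x + y) = \<psi> x + \<psi> y" for x y
    proof (induction x rule: frakM.abs_induct, induction y rule: frakM.abs_induct)
      case (1 x y)
      show ?case by (simp add: plus_frakM.abs_eq abs_M linear_extension_add)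
    qed
    show "\<psi> (scaleM c x) = c * \<psi> x" for c x
    proof (induction x rule: frakM.abs_induct)
      case (1 x)
      show ?case by (simp add: scaleM.abs_eq abs_M linear_extension_scale)
    qed
    show "\<psi> (foldl act v (map e w)) = f w" for w
      unfolding v_def foldl_act_tensor
      by (simp add: tensor.abs_eq abs_M prod_list_e abs word_functional_def)
  qed
qed

section \<open>Linear independence\<close>

abbreviation vec :: "int list \<Rightarrow> frakM" where
  "vec w \<equiv> foldl act v (map e w)"

lemma pairing_functional:
  obtains \<psi> :: "frakM \<Rightarrow> complex" where
    "\<And>x y. \<psi> (x + y) = \<psi> x + \<psi> y" "\<And>c x. \<psi> (scaleM c x) = c * \<psi> x"
    "\<And>w. \<psi> (vec w) = of_nat (pairing u w)"
proof (rule functional_on_module[of "\<lambda>w. of_nat (pairing u w)"])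
  show "letter_relation (\<lambda>w. of_nat (pairing u w))"
    unfolding letter_relation_def pairing_def of_nat_add[symmetric]
    using coeff_chain_relation[OF swap_invariant_monomial_symmetric] by simp
  show "of_nat (pairing u (i # w)) = (0 :: complex)" if "i > 0" for i w
    using that by (simp add: pairing_def)
qed (rule that)

text \<open>In a nontrivial linear relation, the functional of a word of least energy among those that occur
  sees only this word.\<close>
lemma vec_words_independent:
  assumes "finite I" "\<And>w. w \<in> I \<Longrightarrow> slow_growth 0 w"
    and sum: "(\<Sum>w\<in>I. scaleM (c w) (vec w)) = 0"
    and "w \<in> I"
  shows "c w = 0"
proof (rule ccontr)
  assume "c w \<noteq> 0"
  then obtain u where u: "u \<in> I" "c u \<noteq> 0" and min: "\<And>t. t \<in> I \<Longrightarrow> c t \<noteq> 0 \<Longrightarrow> energy u \<le> energy t"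
    using ex_has_least_nat[of "\<lambda>t. t \<in> I \<and> c t \<noteq> 0" w energy] \<open>w \<in> I\<close> by blast
  obtain \<psi> :: "frakM \<Rightarrow> complex" where \<psi>: "\<And>x y. \<psi> (x + y) = \<psi> x + \<psi> y"
    "\<And>c x. \<psi> (scaleM c x) = c * \<psi> x" "\<And>w. \<psi> (vec w) = of_nat (pairing u w)"
    using pairing_functional by blast
  have zero: "\<psi> 0 = 0" using \<psi>(2)[of 0 0] by simp
  have "\<psi> (\<Sum>w\<in>I. scaleM (c w) (vec w)) = (\<Sum>w\<in>I. \<psi> (scaleM (c w) (vec w)))"
    using sum_comp_morphism[of \<psi> "\<lambda>w. scaleM (c w) (vec w)" I] zero \<psi>(1) by (simp add: o_def)
  then have "0 = (\<Sum>t\<in>I. c t * of_nat (pairing u t))"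
    by (simp add: sum zero \<psi>)
  also have "\<dots> = (\<Sum>t\<in>{u}. c t * of_nat (pairing u t))"
  proof (rule sum.mono_neutral_right)
    show "\<forall>t\<in>I - {u}. c t * of_nat (pairing u t) = 0"
      using pairing_triangular[of u] min assms(2) u(1) by fastforce
  qed (use assms(1) u(1) in auto)
  finally show False using pairing_self[of u] assms(2) u by simp
qed

lemma inj_on_vec:
  assumes "\<And>w. w \<in> I \<Longrightarrow> slow_growth 0 w"
  shows "inj_on vec I"
proof (rule inj_onI, rule ccontr)
  fix u w assume uw: "u \<in> I" "w \<in> I" "vec u = vec w" "u \<noteq> w"
  let ?c = "\<lambda>t. if t = u then 1 else - 1"
  have "(\<Sum>t\<in>{u, w}. scaleM (?c t) (vec t)) = 0"
    using uw by simp
  from vec_words_independent[OF _ _ this, of u] show False using uw assms by auto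
qed

lemma independent_vec:
  assumes "finite I" "\<And>w. w \<in> I \<Longrightarrow> slow_growth 0 w"
  shows "M.independent (vec ` I)"
proof (rule M.independent_if_scalars_zero)
  fix c x assume "(\<Sum>x\<in>vec ` I. scaleM (c x) x) = 0" "x \<in> vec ` I"
  then show "c x = 0"
    using vec_words_independent[OF assms, of "\<lambda>w. c (vec w)"] inj_on_vec[of I] assms(2)
    by (auto simp: sum.reindex)
qed (use assms(1) in simp)

section \<open>Spanning\<close>

definition words :: "nat \<Rightarrow> int \<Rightarrow> int list set" where
  "words n k = {w. length w = n \<and> slow_growth k w}"

text \<open>The position of each letter weighted by its size. Each rewriting step moves size to the left and
  so decreases this measure.\<close>
fun weight :: "nat \<Rightarrow> int list \<Rightarrow> nat" where
  "weight m [] = 0"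
| "weight m (i # w) = m * nat i + weight (Suc m) w"

lemma weight_append: "weight m (u @ w) = weight m u + weight (m + length u) w"
  by (induction u arbitrary: m) auto

text \<open>The two ways to leave the basis: the word starts too high, or it has a jump to which the rewriting
  rule applies.\<close>
lemma not_slow_growthE:
  assumes "\<not> slow_growth k w" "set w \<subseteq> {0..}"
  obtains i t where "w = i # t" "i > k"
  | u i j t where "w = u @ i # j # t" "j \<ge> i + 2"
proof -
  have "(\<exists>i t. w = i # t \<and> i > k) \<or> (\<exists>u i j t. w = u @ i # j # t \<and> j \<ge> i + 2)"
    using assms
  proof (induction w arbitrary: k)
    case (Cons i w)
    show ?case
    proof (cases "i > k")
      case False
      with Cons.prems have "\<not> slow_growth (i + 1) w" "set w \<subseteq> {0..}" by auto
      from Cons.IH[OF this] show ?thesis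
      proof (elim disjE exE conjE)
        fix j t assume "w = j # t" "j > i + 1"
        then have "i # w = [] @ i # j # t" "j \<ge> i + 2" by auto
        then show ?thesis by blast
      next
        fix u a b t assume "w = u @ a # b # t" "b \<ge> a + 2"
        then have "i # w = (i # u) @ a # b # t" by simp
        then show ?thesis using \<open>b \<ge> a + 2\<close> by blast
      qed
    qed auto
  qed auto
  then show thesis using that by blast
qed

lemma foldl_act_zero: "foldl act 0 as = 0"
  by (induction as) (simp_all add: act_zero_left)

lemma vec_pos: "i > 0 \<Longrightarrow> vec (i # w) = 0"
  by (simp add: act_v_e foldl_act_zero)

lemma vec_exchange:
  "vec (u @ i # j # w) = vec (u @ (i + 1) # (j - 1) # w) + vec (u @ (j - 1) # (i + 1) # w)
     - vec (u @ j # i # w)"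
proof -
  have "vec (u @ i # j # w) + vec (u @ j # i # w) =
    tensor 1 (prod_list (map e u) * anticomm (e i) (e j) * prod_list (map e w))" for i j
    by (simp add: v_def foldl_act_tensor tensor_add_right[symmetric] anticomm_def algebra_simps)
  from this[of i j] this[of "i + 1" "j - 1"] show ?thesis
    by (simp only: e_rel[of i j]) (simp add: eq_diff_eq)
qed

lemma weight_exchange:
  assumes "0 \<le> i" "i < a" "a \<le> j" "i + j = a + b"
  shows "weight m (u @ a # b # w) < weight m (u @ i # j # w)"
proof -
  let ?m = "m + length u"
  have "?m * nat a + ?m * nat b = ?m * nat i + ?m * nat j"
    using assms by (simp add: distrib_left[symmetric] nat_add_distrib[symmetric])
  moreover have "nat b < nat j" using assms by linarith
  ultimately have "(?m * nat a + ?m * nat b) + nat b < (?m * nat i + ?m * nat j) + nat j"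
    by (simp only: add_less_cancel_left)
  then show ?thesis by (simp add: weight_append add_ac)
qed

lemma vec_in_span:
  assumes "length w = n" "set w \<subseteq> {0..}"
  shows "vec w \<in> M.span (vec ` words n 0)"
  using assms
proof (induction "weight 0 w" arbitrary: w rule: less_induct)
  case less
  show ?case
  proof (cases "slow_growth 0 w")
    case True
    then show ?thesis using less.prems by (intro M.span_base) (auto simp: words_def)
  next
    case False
    from this less.prems(2) show ?thesis
    proof (cases rule: not_slow_growthE)
      case (1 i t)
      then show ?thesis by (simp only: vec_pos M.span_zero)
    next
      case (2 u i j t)
      have "i \<ge> 0" using less.prems 2 by simp
      have "vec (u @ a # b # t) \<in> M.span (vec ` words n 0)"
        if "i < a" "a \<le> j" "i + j = a + b" for a b
      proof (rule less.hyps)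
        show "weight 0 (u @ a # b # t) < weight 0 w"
          unfolding 2(1) using weight_exchange \<open>i \<ge> 0\<close> that by blast
        show "length (u @ a # b # t) = n" "set (u @ a # b # t) \<subseteq> {0..}"
          using less.prems 2 that by auto
      qed
      from this[of "i + 1" "j - 1"] this[of "j - 1" "i + 1"] this[of j i]
      show ?thesis
        unfolding 2(1) vec_exchange[of u i j t] using 2(2)
        by (intro M.span_add M.span_diff) auto
    qed
  qed
qed

section \<open>Counting the basis\<close>

lemma words_0: "words 0 k = {[]}" by (auto simp: words_def)

lemma words_Suc: "words (Suc n) k = (\<Union>i\<in>{0..k}. (#) i ` words n (i + 1))"
  by (auto simp: words_def length_Suc_conv)

lemma finite_words: "finite (words n k)"
  by (induction n arbitrary: k) (auto simp: words_0 words_Suc)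

lemma card_words_Suc: "card (words (Suc n) k) = (\<Sum>i\<in>{0..k}. card (words n (i + 1)))"
  unfolding words_Suc by (subst card_UN_disjoint) (auto simp: finite_words card_image)

text \<open>The ballot numbers \<open>B(n, k)\<close> satisfy \<open>B(n+1, k) = B(n+1, k-1) + B(n, k+1)\<close> by splitting off the
  largest admissible first letter, and so does the difference of binomial coefficients by Pascal's
  rule.\<close>
lemma card_words: "int (card (words (Suc n) (int k))) =
   int ((2 * n + 2 + k) choose (n + 1)) - int ((2 * n + 2 + k) choose n)"
proof (induction n arbitrary: k)
  case 0
  show ?case by (simp add: card_words_Suc words_0)
next
  case (Suc n)
  show ?case
  proof (induction k)
    case 0
    have "card (words (Suc (Suc n)) (int 0)) = card (words (Suc n) (int 1))"
      by (simp add: card_words_Suc[of "Suc n"])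
    moreover have "(2 * n + 3) choose (n + 2) = (2 * n + 3) choose (n + 1)"
      using binomial_symmetric[of "n + 1" "2 * n + 3"] by (simp add: numeral_eq_Suc)
    moreover have "int ((2 * Suc n + 2 + 0) choose (Suc n + 1)) = int ((2 * n + 3) choose (n + 1)) + int ((2 * n + 3) choose (n + 2))"
      "int ((2 * Suc n + 2 + 0) choose (Suc n)) = int ((2 * n + 3) choose n) + int ((2 * n + 3) choose (n + 1))"
      by (simp_all add: numeral_eq_Suc)
    ultimately show ?case using Suc.IH[of 1] by (simp add: numeral_eq_Suc)
  next
    case (Suc k)
    have "{0..int (Suc k)} = insert (int (Suc k)) {0..int k}" by auto
    then have "card (words (Suc (Suc n)) (int (Suc k))) =
      card (words (Suc (Suc n)) (int k)) + card (words (Suc n) (int (k + 2)))"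
      by (simp add: card_words_Suc[of "Suc n"] add_ac)
    moreover have "int ((2 * Suc n + 2 + Suc k) choose (Suc n + 1)) =
       int ((2 * Suc n + 2 + k) choose (Suc n + 1)) + int ((2 * Suc n + 2 + k) choose (Suc n))"
      "int ((2 * Suc n + 2 + Suc k) choose (Suc n)) =
       int ((2 * Suc n + 2 + k) choose (Suc n)) + int ((2 * Suc n + 2 + k) choose n)"
      by simp_all
    ultimately show ?case using Suc.IH \<open>\<And>k. int (card (words (Suc n) (int k))) = _ k\<close>[of "k + 2"]
      by (simp add: add_ac)
  qed
qed

lemma slow_growth_nonneg: "slow_growth k w \<Longrightarrow> set w \<subseteq> {0..}"
  by (induction w arbitrary: k) auto

theorem theorem4:
  fixes n :: nat
  assumes "n \<ge> 1"
  shows "real (M.dim (P n)) = 1 / (real n + 1) * real ((2 * n) choose n)"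
proof -
  have dim: "M.dim (P n) = card (words n 0)"
  proof (rule M.dim_unique)
    show "vec ` words n 0 \<subseteq> P n"
      unfolding P_eq_span_e words_def
      using slow_growth_nonneg by (fastforce intro: M.span_base)
    show "P n \<subseteq> M.span (vec ` words n 0)"
      unfolding P_eq_span_e
      by (rule M.span_minimal) (auto intro: vec_in_span M.subspace_span)
    have slow: "slow_growth 0 w" if "w \<in> words n 0" for w
      using that by (simp add: words_def)
    show "M.independent (vec ` words n 0)"
      using finite_words slow by (rule independent_vec)
    show "card (vec ` words n 0) = card (words n 0)"
      using slow by (intro card_image inj_on_vec)
  qed
  obtain m where n: "n = Suc m" using assms by (cases n) auto
  define X Y where "X = real ((2 * m + 2) choose Suc m)" and "Y = real ((2 * m + 2) choose m)"
  have card: "real (card (words n 0)) = X - Y"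
    unfolding n X_def Y_def using arg_cong[OF card_words[of m 0], of real_of_int] by simp
  \<comment> \<open>Both sides are equal to \<open>(2 * m + 2) * ((2 * m + 1) choose m)\<close>.\<close>
  have "Suc m * ((2 * m + 2) choose Suc m) = (2 * m + 2 - m) * ((2 * m + 2) choose m)"
    using binomial_absorption[of m "2 * m + 2"] binomial_absorb_comp[of "2 * m + 2" m] by presburger
  moreover have "Suc m = m + 1" "2 * m + 2 - m = m + 2" by simp_all
  ultimately have "real (m + 1) * X = real (m + 2) * Y"
    unfolding X_def Y_def by (simp only: flip: of_nat_mult)
  then have "(real n + 1) * real (card (words n 0)) = X"
    unfolding card unfolding n by (simp add: algebra_simps)
  moreover have "real ((2 * n) choose n) = X" by (simp add: n X_def)
  ultimately show ?thesis unfolding dim by (simp add: divide_simps mult.commute)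
qed

end
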